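(* Let $k,h\ge 1$ and $\alpha,\beta\in[0,\frac12)$, and let $\boldsymbol{\epsilon}=(\alpha,\beta)$. For arbitrarily large $n$ and $d$ there exist sequences of $n$ insertion and deletion operations over $\{0,1\}^d\times\{0,1\}$ such that, in the matrix access model, any weakly $(\boldsymbol{\epsilon},\frac23)$-feasible fully dynamic algorithm with pruning thresholds $k,h$ has expected running time $\Omega(nd)$.
   Context: **Matrix access model.** The algorithm is not required to read the examples upon arrival; at any point in time it can access in time $O(1)$ the $j$-th feature of any example in the current active set. **Examples and Gini gain.** The feature domain is $\mathcal{X}=\{0,1\}^d$, labels are in $\{0,1\}$. $S$ denotes a finite multiset of labeled examples $(x,y)\in\mathcal{X}\times\{0,1\}$; $x_j$ is the $j$-th feature of $x$; $[d]=\{1,\dots,d\}$. $S[x_j\le t]=\{(x,y)\in S: x_j\le t\}$ (as a sub-multiset), and similarly for $S[x_j>t]$. A split is a pair $(j,t)\in[d]\times\mathbb{R}$. The Gini index of $S$ is $g(S)=2p_S(1-p_S)$ with $p_S=\frac1{|S|}\sum_{(x,y)\in S}y$. The Gini gain of $(j,t)$ on $S$ is $G(S,j,t)=g(S)-\big(\frac{|S_-|}{|S|}g(S_-)+\frac{|S_+|}{|S|}g(S_+)\big)$ where $S_-=S[x_j\le t]$, $S_+=S[x_j>t]$. If $|S|=0$ then $g(S)=0$ and $G(S,j,t)=0$. **Decision trees.** A decision tree is a triple $(T,\Sigma,L)$ where $T$ is a rooted directed binary tree with vertex set $V(T)$, $\Sigma$ assigns a split $\sigma_v=(j_v,t_v)$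 to each internal node $v$, and $L$ assigns a label $L_v\in\{0,1\}$ to each leaf. An $x\in\mathcal{X}$ arriving at internal node $v$ goes to the left child if $x_{j_v}\le t_v$ and to the right child otherwise. $S_v$ denotes the sub-multiset of $S$ of those examples whose root-to-leaf route passes through $v$. $T(x)$ is the label of the leaf reached by $x$. The root has depth $0$. **Feasibility.** $(T,\Sigma,L)$ is $(\alpha,\beta)$-feasible with pruning thresholds $(k,h)$ w.r.t. $S$ if for every $v\in V(T)$: (1) if $|S_v|\le k$ or $g(S_v)=0$ or $\mathrm{depth}_T(v)=h$ then $v$ is a leaf, else if $g(S_v)\ge\alpha$ then $v$ is an internal node; (2) if $\sigma_v=(j,a)$ then $G(S_v,j,a)\ge G(S_v,j',a')-\beta$ for all $(j',a')\in[d]\times\mathbb{R}$; (3) if $v$ is a leaf then $L_v$ is a majority label of $S_v$. **Fully dynamic algorithms and weak feasibility.** A fully dynamic decision tree algorithm $\mathcal{A}$ (possibly randomized) receives an arbitrary sequence of requests of three types: insertion $\mathrm{ins}(x,y)$, deletion $\mathrm{del}(x,y)$, labeling $\mathrm{lab}(x)$. The sequence induces an active multiset $S$, obtained by performing the insertions and deletions in order; $\mathcal{A}_S(x)$ denotes the answer of $\mathcal{A}$ to $\mathrm{lab}(x)$ when the active multiset is $S$. $\mathcal{A}$ is weakly $(\boldsymbol{\epsilon},\delta)$-feasible w.r.t. $S$ if for every $x\in\mathcal{X}$ there is a decision tree $(T_x,\Sigma_x,L_x)$ that is $\boldsymbol{\epsilon}$-feasible w.r.t. $S$ (for the given pruning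 thresholds) and such that $\Pr(\mathcal{A}_S(x)=T_x(x))\ge\delta$. The fully dynamic algorithm is weakly $(\boldsymbol{\epsilon},\delta)$-feasible if this holds at every point in time w.r.t. the current active multiset, for every request sequence fixed in advance (oblivious adversary).
   Formalization: The sequences of n insertions and deletions are interleaved with at most n labeling requests, since on updates alone a lazy algorithm that reads features only when labeling is feasible and takes O(n) time; the Ω constant may depend on k, h, α, β. *)

theory Defs
  imports "HOL-Probability.Probability" "HOL-Library.Multiset"
begin

section \<open>Examples and Gini gain\<close>

text \<open>
  A point of the feature domain of dimension \<open>d\<close> is a bit list of length \<open>d\<close>;
  features are numbered from \<open>0\<close> to \<open>d - 1\<close>.
\<close>

type_synonym point = "bool list"
type_synonym example = "point \<times> bool"

definition feature :: "point \<Rightarrow> nat \<Rightarrow> real" where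
  "feature x j = of_bool (x ! j)"

definition part_le :: "example multiset \<Rightarrow> nat \<Rightarrow> real \<Rightarrow> example multiset" where
  "part_le S j t = filter_mset (\<lambda>(x, y). feature x j \<le> t) S"

definition part_gt :: "example multiset \<Rightarrow> nat \<Rightarrow> real \<Rightarrow> example multiset" where
  "part_gt S j t = filter_mset (\<lambda>(x, y). feature x j > t) S"

text \<open>
  On the empty multiset division by zero makes \<open>label_mean\<close>, \<open>gini\<close> and \<open>gini_gain\<close>
  equal to \<open>0\<close>, which is the intended convention.
\<close>

definition label_mean :: "example multiset \<Rightarrow> real" where
  "label_mean S = (\<Sum>(x, y)\<in>#S. of_bool y) / real (size S)"

definition gini :: "example multiset \<Rightarrow> real" where
  "gini S = 2 * label_mean S * (1 - label_mean S)"

definition gini_gain :: "example multiset \<Rightarrow> nat \<Rightarrow> real \<Rightarrow> real" where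
  "gini_gain S j t = gini S -
     (real (size (part_le S j t)) / real (size S) * gini (part_le S j t) +
      real (size (part_gt S j t)) / real (size S) * gini (part_gt S j t))"

definition majority_label :: "example multiset \<Rightarrow> bool \<Rightarrow> bool" where
  "majority_label S b \<longleftrightarrow>
     size (filter_mset (\<lambda>(x, y). y \<noteq> b) S) \<le> size (filter_mset (\<lambda>(x, y). y = b) S)"


section \<open>Decision trees\<close>

text \<open>
  A vertex of a tree is identified with its path from the root, \<open>False\<close> meaning left and
  \<open>True\<close> meaning right; its depth is the length of that path.
\<close>

datatype dtree = Leaf bool | Node nat real dtree dtree

fun subtree_at :: "dtree \<Rightarrow> bool list \<Rightarrow> dtree option" where
  "subtree_at T [] = Some T"
| "subtree_at (Leaf b) (_ # _) = None"
| "subtree_at (Node j t l r) (right # v) = subtree_at (if right then r else l) v"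

definition vertices :: "dtree \<Rightarrow> bool list set" where
  "vertices T = {v. subtree_at T v \<noteq> None}"

definition is_leaf :: "dtree \<Rightarrow> bool list \<Rightarrow> bool" where
  "is_leaf T v \<longleftrightarrow> (\<exists>b. subtree_at T v = Some (Leaf b))"

text \<open>The path from the root to the leaf reached by a point.\<close>

fun route :: "dtree \<Rightarrow> point \<Rightarrow> bool list" where
  "route (Leaf b) x = []"
| "route (Node j t l r) x =
     (if feature x j \<le> t then False # route l x else True # route r x)"

fun predict :: "dtree \<Rightarrow> point \<Rightarrow> bool" where
  "predict (Leaf b) x = b"
| "predict (Node j t l r) x = (if feature x j \<le> t then predict l x else predict r x)"

definition examples_at :: "dtree \<Rightarrow> example multiset \<Rightarrow> bool list \<Rightarrow> example multiset" where
  "examples_at T S v = filter_mset (\<lambda>(x, y). take (length v) (route T x) = v) S"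

text \<open>\<open>(\<alpha>, \<beta>)\<close>-feasibility in dimension \<open>d\<close> with pruning thresholds \<open>(k, h)\<close>.\<close>

definition feasible ::
  "nat \<Rightarrow> nat \<Rightarrow> nat \<Rightarrow> real \<Rightarrow> real \<Rightarrow> example multiset \<Rightarrow> dtree \<Rightarrow> bool" where
  "feasible d k h \<alpha> \<beta> S T \<longleftrightarrow>
     (\<forall>v\<in>vertices T. let Sv = examples_at T S v in
        (if size Sv \<le> k \<or> gini Sv = 0 \<or> length v = h then is_leaf T v
         else gini Sv \<ge> \<alpha> \<longrightarrow> \<not> is_leaf T v) \<and>
        (\<forall>j a l r. subtree_at T v = Some (Node j a l r) \<longrightarrow>
           j < d \<and> (\<forall>j' a'. j' < d \<longrightarrow> gini_gain Sv j a \<ge> gini_gain Sv j' a' - \<beta>)) \<and>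
        (\<forall>b. subtree_at T v = Some (Leaf b) \<longrightarrow> majority_label Sv b))"


section \<open>Request sequences\<close>

datatype request = Ins point bool | Del point bool | Lab point

text \<open>
  The active examples are kept in a table of rows, each carrying a handle: the position, in the
  request sequence, of the insertion that created it.  Since a deletion names an example by
  value, it removes the oldest active copy.
\<close>

definition oldest_copy :: "example \<Rightarrow> (nat \<times> example) list \<Rightarrow> (nat \<times> example) option" where
  "oldest_copy e R = find (\<lambda>rw. snd rw = e) R"

fun exec_request ::
  "nat \<times> request \<Rightarrow> (nat \<times> example) list \<Rightarrow> (nat \<times> example) list" where
  "exec_request (i, Ins x y) R = R @ [(i, (x, y))]"
| "exec_request (i, Del x y) R =
     (case oldest_copy (x, y) R of None \<Rightarrow> R | Some rw \<Rightarrow> remove1 rw R)"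
| "exec_request (i, Lab x) R = R"

definition table :: "request list \<Rightarrow> (nat \<times> example) list" where
  "table \<sigma> = fold exec_request (List.enumerate 0 \<sigma>) []"

definition active :: "request list \<Rightarrow> example multiset" where
  "active \<sigma> = mset (map snd (table \<sigma>))"

text \<open>Sanity check: \<open>active\<close> performs the insertions and deletions in order.\<close>

lemma active_Nil: "active [] = {#}"
  by (simp add: active_def table_def)

lemma active_Ins: "active (\<sigma> @ [Ins x y]) = add_mset (x, y) (active \<sigma>)"
  by (simp add: active_def table_def enumerate_append_eq)

lemma active_Del: "active (\<sigma> @ [Del x y]) = active \<sigma> - {#(x, y)#}"
proof -
  have *: "image_mset snd (mset (case oldest_copy e R of None \<Rightarrow> R | Some rw \<Rightarrow> remove1 rw R))
      = image_mset snd (mset R) - {#e#}" for e :: example and R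
  proof (cases "oldest_copy e R")
    case None
    then have "e \<notin># image_mset snd (mset R)"
      unfolding oldest_copy_def find_None_iff by fastforce
    with None show ?thesis
      by (simp add: diff_single_trivial)
  next
    case (Some rw)
    then have "rw \<in> set R" and "snd rw = e"
      by (auto simp: oldest_copy_def find_Some_iff)
    with Some show ?thesis
      by (simp add: image_mset_Diff)
  qed
  show ?thesis
    by (simp add: active_def table_def enumerate_append_eq *)
qed

lemma active_Lab: "active (\<sigma> @ [Lab x]) = active \<sigma>"
  by (simp add: active_def table_def enumerate_append_eq)

fun is_lab :: "request \<Rightarrow> bool" where
  "is_lab (Lab x) = True"
| "is_lab _ = False"

definition num_updates :: "request list \<Rightarrow> nat" where
  "num_updates \<sigma> = length (filter (\<lambda>r. \<not> is_lab r) \<sigma>)"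

definition num_labelings :: "request list \<Rightarrow> nat" where
  "num_labelings \<sigma> = length (filter is_lab \<sigma>)"

definition valid_requests :: "nat \<Rightarrow> request list \<Rightarrow> bool" where
  "valid_requests d \<sigma> \<longleftrightarrow> (\<forall>i<length \<sigma>. case \<sigma> ! i of
       Ins x y \<Rightarrow> length x = d
     | Del x y \<Rightarrow> length x = d \<and> (x, y) \<in># active (take i \<sigma>)
     | Lab x \<Rightarrow> length x = d)"


section \<open>Algorithms in the matrix access model\<close>

text \<open>
  An algorithm works in elementary steps of unit cost.  A step probes one feature of one row,
  flips a fair coin, performs some internal computation, or completes the current request (the
  returned bit is the answer to a labeling request and is ignored for updates).

  Whatever an algorithm stores is determined by what it has observed, so an algorithm is
  modelled as an arbitrary function from the history of its observations (most recent first) to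
  the next step.  This places no restriction on what one internal step computes, nor on memory;
  every algorithm for a concrete machine with matrix access is an instance, up to a constant
  factor in the running time.

  A newly inserted example is announced by its handle and its label only; its features have to
  be probed.  A deletion is announced by the handle of the deleted row.  The point of a
  labeling request is revealed entirely, free of charge.
\<close>

datatype action =
    Probe nat nat \<comment> \<open>handle, feature\<close>
  | Flip
  | Compute
  | Finish bool

datatype event =
    Inserted nat bool
  | Deleted nat
  | Asked point
  | Probed "bool option"
  | Flipped bool
  | Computed
  | Finished bool

type_synonym algorithm = "event list \<Rightarrow> action"

text \<open>
  What is announced when request number \<open>m\<close> arrives; nothing, if there is no such request.
\<close>

definition announce :: "request list \<Rightarrow> nat \<Rightarrow> event list" where
  "announce \<sigma> m =
     (if m < length \<sigma> then
        (case \<sigma> ! m of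
           Ins x y \<Rightarrow> [Inserted m y]
         | Del x y \<Rightarrow> (case oldest_copy (x, y) (table (take m \<sigma>)) of
                         None \<Rightarrow> [] | Some rw \<Rightarrow> [Deleted (fst rw)])
         | Lab x \<Rightarrow> [Asked x])
      else [])"

text \<open>
  The result of a probe during request number \<open>m\<close>.  Besides the rows that are active after
  this request, the row that is being deleted by it can still be read.  Probing any other
  row, or a feature outside the dimension, yields \<open>None\<close>.
\<close>

definition probe :: "request list \<Rightarrow> nat \<Rightarrow> nat \<Rightarrow> nat \<Rightarrow> bool option" where
  "probe \<sigma> m i j =
     (case map_of (table (take m \<sigma>) @ table (take (Suc m) \<sigma>)) i of
        None \<Rightarrow> None
      | Some (x, y) \<Rightarrow> if j < length x then Some (x ! j) else None)"

text \<open>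
  \<open>served\<close> is the number of completed requests, \<open>coins\<close> the unread part of the random tape and
  \<open>answer\<close> the bit returned for the request completed last.
\<close>

record config =
  served :: nat
  history :: "event list"
  coins :: "bool stream"
  answer :: bool

definition initial :: "request list \<Rightarrow> bool stream \<Rightarrow> config" where
  "initial \<sigma> \<omega> = \<lparr>served = 0, history = announce \<sigma> 0, coins = \<omega>, answer = False\<rparr>"

definition halted :: "request list \<Rightarrow> config \<Rightarrow> bool" where
  "halted \<sigma> c \<longleftrightarrow> served c = length \<sigma>"

definition step :: "algorithm \<Rightarrow> request list \<Rightarrow> config \<Rightarrow> config" where
  "step A \<sigma> c =
     (if halted \<sigma> c then c
      else (case A (history c) of
          Probe i j \<Rightarrow> c\<lparr>history := Probed (probe \<sigma> (served c) i j) # history c\<rparr>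
        | Flip \<Rightarrow> c\<lparr>history := Flipped (shd (coins c)) # history c, coins := stl (coins c)\<rparr>
        | Compute \<Rightarrow> c\<lparr>history := Computed # history c\<rparr>
        | Finish b \<Rightarrow> c\<lparr>served := Suc (served c),
                         history := announce \<sigma> (Suc (served c)) @ Finished b # history c,
                         answer := b\<rparr>))"

definition run :: "algorithm \<Rightarrow> request list \<Rightarrow> bool stream \<Rightarrow> nat \<Rightarrow> config" where
  "run A \<sigma> \<omega> t = (step A \<sigma> ^^ t) (initial \<sigma> \<omega>)"

text \<open>The running time is \<open>\<infinity>\<close> if the algorithm never completes the last request.\<close>

definition running_time :: "algorithm \<Rightarrow> request list \<Rightarrow> bool stream \<Rightarrow> enat" where
  "running_time A \<sigma> \<omega> = Inf {enat t |t. halted \<sigma> (run A \<sigma> \<omega> t)}"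

definition coin_space :: "bool stream measure" where
  "coin_space = stream_space (measure_pmf (bernoulli_pmf (1/2)))"

definition expected_running_time :: "algorithm \<Rightarrow> request list \<Rightarrow> ennreal" where
  "expected_running_time A \<sigma> =
     (\<integral>\<^sup>+ \<omega>. ennreal_of_enat (running_time A \<sigma> \<omega>) \<partial>coin_space)"

text \<open>
  The event that the algorithm completes the whole request sequence and returns \<open>b\<close> for the
  last request.
\<close>

definition last_answer_is :: "algorithm \<Rightarrow> request list \<Rightarrow> bool stream \<Rightarrow> bool \<Rightarrow> bool" where
  "last_answer_is A \<sigma> \<omega> b \<longleftrightarrow>
     (\<exists>t. halted \<sigma> (run A \<sigma> \<omega> t) \<and> answer (run A \<sigma> \<omega> t) = b)"

text \<open>
  Weak feasibility holds at every point in time: after any valid request sequence \<open>\<sigma>\<close>, possibly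
  containing labeling requests, a labeling request for any point is answered correctly with
  probability at least \<open>\<delta>\<close>.  The sequence is fixed before the coins are flipped (oblivious
  adversary), and the tree may depend on the point.
\<close>

definition weakly_feasible ::
  "nat \<Rightarrow> nat \<Rightarrow> nat \<Rightarrow> real \<Rightarrow> real \<Rightarrow> real \<Rightarrow> algorithm \<Rightarrow> bool" where
  "weakly_feasible d k h \<alpha> \<beta> \<delta> A \<longleftrightarrow>
     (\<forall>\<sigma>. valid_requests d \<sigma> \<longrightarrow>
       (\<forall>x. length x = d \<longrightarrow>
         (\<exists>T. feasible d k h \<alpha> \<beta> (active \<sigma>) T \<and>
              measure coin_space
                {\<omega> \<in> space coin_space. last_answer_is A (\<sigma> @ [Lab x]) \<omega> (predict T x)} \<ge> \<delta>)))"

end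

theory Submission
  imports Defs
begin

text \<open>
  While the table holds \<open>k\<close> zero vectors with each label, the answer to a query \<open>x\<close> is
  unconstrained, but switching on feature \<open>j\<close> in the positive rows makes \<open>j\<close> the only admissible
  root split and forces the answer \<open>x ! j\<close>.  Whatever bit \<open>b\<close> the algorithm prefers on the zero
  table, it must therefore probe, with probability at least \<open>1/3\<close>, every column \<open>j\<close> with
  \<open>x ! j \<noteq> b\<close>.  If \<open>x\<close> has as many ones as zeros there are \<open>d/2\<close> such columns.  Deleting the
  rows and inserting fresh copies makes the algorithm pay this price again every \<open>4 k\<close> updates.
\<close>

section \<open>Runs\<close>

lemma run_0 [simp]: "run A \<sigma> \<omega> 0 = initial \<sigma> \<omega>"
  by (simp add: run_def)

lemma run_Suc [simp]: "run A \<sigma> \<omega> (Suc t) = step A \<sigma> (run A \<sigma> \<omega> t)"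
  by (simp add: run_def)

lemma run_halted:
  assumes "halted \<sigma> (run A \<sigma> \<omega> s)" and "s \<le> t"
  shows "run A \<sigma> \<omega> t = run A \<sigma> \<omega> s"
  using assms(2) by (induction rule: dec_induct) (simp_all add: assms(1) step_def)

lemma served_le: "served (run A \<sigma> \<omega> t) \<le> length \<sigma>"
  by (induction t) (auto simp: initial_def step_def halted_def split: action.splits)

lemma last_answer_unique:
  assumes "last_answer_is A \<sigma> \<omega> b" and "halted \<sigma> (run A \<sigma> \<omega> t)"
  shows "answer (run A \<sigma> \<omega> t) = b"
proof -
  obtain s where s: "halted \<sigma> (run A \<sigma> \<omega> s)" "answer (run A \<sigma> \<omega> s) = b"
    using assms(1) by (auto simp: last_answer_is_def)
  have "run A \<sigma> \<omega> s = run A \<sigma> \<omega> t"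
    using nat_le_linear[of s t]
  proof
    assume "s \<le> t"
    from run_halted[OF s(1) this] show ?thesis ..
  qed (rule run_halted[OF assms(2)])
  with s(2) show ?thesis
    by simp
qed

text \<open>Distinct times before halting are distinct unit-cost steps. Later \<open>f\<close> picks
  one time per (block, column) pair. A run that never halts is covered: its time is the infimum of
  the empty set.\<close>

lemma card_le_running_time:
  assumes inj: "inj_on f K" and "\<And>p. p \<in> K \<Longrightarrow> \<not> halted \<sigma> (run A \<sigma> \<omega> (f p))"
  shows "enat (card K) \<le> running_time A \<sigma> \<omega>"
  unfolding running_time_def
proof (rule Inf_greatest, clarsimp)
  fix t assume "halted \<sigma> (run A \<sigma> \<omega> t)"
  then have "f p < t" if "p \<in> K" for p
    using assms(2)[OF that] run_halted[of \<sigma> A \<omega> t "f p"] by (cases "f p < t") auto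
  then have "f ` K \<subseteq> {..<t}"
    by blast
  then show "card K \<le> t"
    using card_mono[of "{..<t}" "f ` K"] card_image[OF inj] by simp
qed

section \<open>Request sequences that look alike to an algorithm\<close>

text \<open>\<open>D\<close> holds the table entries by which the two sequences may be told apart.
  Only the requests of \<open>\<tau>\<close> are compared, because it will stop at a query after
  which \<open>\<sigma>\<close> goes on.\<close>

definition same_view :: "(nat \<times> nat) set \<Rightarrow> request list \<Rightarrow> request list \<Rightarrow> bool" where
  "same_view D \<sigma> \<tau> \<longleftrightarrow> length \<tau> \<le> length \<sigma> \<and>
     (\<forall>m<length \<tau>. announce \<sigma> m = announce \<tau> m \<and>
        (\<forall>i j. (i, j) \<notin> D \<longrightarrow> probe \<sigma> m i j = probe \<tau> m i j))"

text \<open>The histories part once \<open>\<tau>\<close> is completed, because \<open>\<sigma>\<close> may announce a further request.\<close>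

lemma run_same_view:
  assumes view: "same_view D \<sigma> \<tau>" and "\<tau> \<noteq> []"
    and "\<And>s. s < t \<Longrightarrow> served (run A \<sigma> \<omega> s) < length \<tau>"
    and "\<And>s i j. s < t \<Longrightarrow> A (history (run A \<sigma> \<omega> s)) = Probe i j \<Longrightarrow> (i, j) \<notin> D"
  shows "served (run A \<tau> \<omega> t) = served (run A \<sigma> \<omega> t) \<and>
    coins (run A \<tau> \<omega> t) = coins (run A \<sigma> \<omega> t) \<and>
    answer (run A \<tau> \<omega> t) = answer (run A \<sigma> \<omega> t) \<and>
    (served (run A \<sigma> \<omega> t) < length \<tau> \<longrightarrow>
      history (run A \<tau> \<omega> t) = history (run A \<sigma> \<omega> t))"
    (is "?P t")
  using assms(3,4)
proof (induction t)
  case 0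
  then show ?case
    using view assms(2) by (auto simp: initial_def same_view_def)
next
  case (Suc t)
  let ?c = "run A \<sigma> \<omega> t" and ?c' = "run A \<tau> \<omega> t"
  have lt: "served ?c < length \<tau>"
    using Suc.prems(1) by simp
  have "?P t"
  proof (rule Suc.IH)
    show "served (run A \<sigma> \<omega> s) < length \<tau>" if "s < t" for s
      using Suc.prems(1)[of s] that by simp
    show "(i, j) \<notin> D" if "s < t" "A (history (run A \<sigma> \<omega> s)) = Probe i j" for s i j
      using Suc.prems(2)[of s i j] that by simp
  qed
  \<comment> \<open>Since \<open>\<tau>\<close> is not yet completed, the histories agree as well,
    so both runs choose the same next action.\<close>
  then have eq: "?c' = ?c"
    using lt by (intro config.equality) auto
  have "probe \<sigma> (served ?c) i j = probe \<tau> (served ?c) i j"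
    if "A (history ?c) = Probe i j" for i j
    using Suc.prems(2)[of t i j] that lt view by (simp add: same_view_def)
  then show ?case
    using view lt eq
    by (cases "A (history ?c)") (auto simp: step_def halted_def same_view_def)
qed

text \<open>On the same coins, the run on \<open>\<sigma>\<close> imitates the run on
  \<open>\<tau>\<close> until \<open>\<tau>\<close> is completed, and likewise the run on
  \<open>\<tau>'\<close> as long as no entry of \<open>D\<close> is probed. Without such a probe the
  two final answers would coincide.\<close>

lemma different_answers_probe:
  assumes "same_view {} \<sigma> \<tau>" and "same_view D \<sigma> \<tau>'"
    and len: "length \<tau>' = length \<tau>" and "\<tau> \<noteq> []"
    and b: "last_answer_is A \<tau> \<omega> b" and b': "last_answer_is A \<tau>' \<omega> b'" and "b \<noteq> b'"
  shows "\<exists>s i j. \<not> halted \<sigma> (run A \<sigma> \<omega> s) \<and> A (history (run A \<sigma> \<omega> s)) = Probe i j \<and> (i, j) \<in> D"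
proof (rule ccontr)
  assume no: "\<not> ?thesis"
  let ?L = "length \<tau>"
  have L: "?L \<le> length \<sigma>"
    using assms(1) by (simp add: same_view_def)
  \<comment> \<open>Otherwise the run on \<open>\<tau>\<close> would copy the run on
    \<open>\<sigma>\<close> forever and never halt, although it has a last answer.\<close>
  have "\<exists>t. ?L \<le> served (run A \<sigma> \<omega> t)"
  proof (rule ccontr)
    assume "\<not> ?thesis"
    then have lt: "served (run A \<sigma> \<omega> t) < ?L" for t
      by (simp add: not_le)
    have "\<not> halted \<tau> (run A \<tau> \<omega> t)" for t
      using run_same_view[OF assms(1,4), of t A \<omega>] lt less_imp_neq[OF lt]
      by (simp add: halted_def)
    then show False
      using b by (simp add: last_answer_is_def)
  qed
  \<comment> \<open>With the least such \<open>t\<close>, all earlier configurations meet the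
    hypotheses of the comparison, and \<open>served_le\<close> makes both shorter runs halted at
    time \<open>t\<close>.\<close>
  then obtain t where t: "?L \<le> served (run A \<sigma> \<omega> t)"
    and before: "\<And>s. s < t \<Longrightarrow> served (run A \<sigma> \<omega> s) < ?L"
    using exists_least_iff[of "\<lambda>t. ?L \<le> served (run A \<sigma> \<omega> t)"] by (auto simp: not_le)
  have 1: "served (run A \<tau> \<omega> t) = served (run A \<sigma> \<omega> t) \<and>
      answer (run A \<tau> \<omega> t) = answer (run A \<sigma> \<omega> t)"
    using run_same_view[OF assms(1,4), of t A \<omega>] before by simp
  have notD: "(i, j) \<notin> D" if "s < t" "A (history (run A \<sigma> \<omega> s)) = Probe i j" for s i j
  proof -
    have "\<not> halted \<sigma> (run A \<sigma> \<omega> s)"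
      using before[OF that(1)] L by (simp add: halted_def)
    with no that(2) show ?thesis
      by blast
  qed
  have "\<tau>' \<noteq> []" and before': "\<And>s. s < t \<Longrightarrow> served (run A \<sigma> \<omega> s) < length \<tau>'"
    using before len assms(4) by auto
  have 2: "served (run A \<tau>' \<omega> t) = served (run A \<sigma> \<omega> t) \<and>
      answer (run A \<tau>' \<omega> t) = answer (run A \<sigma> \<omega> t)"
    using run_same_view[where A = A and \<omega> = \<omega> and t = t,
        OF assms(2) \<open>\<tau>' \<noteq> []\<close> before' notD] by simp
  have "halted \<tau> (run A \<tau> \<omega> t)" "halted \<tau>' (run A \<tau>' \<omega> t)"
    using 1 2 t len served_le[of A \<tau> \<omega> t] served_le[of A \<tau>' \<omega> t] by (auto simp: halted_def)
  then show False
    using last_answer_unique[OF b] last_answer_unique[OF b'] 1 2 \<open>b \<noteq> b'\<close> by simp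
qed


section \<open>Insertions after a request sequence that leaves the table empty\<close>

abbreviation insertions :: "example list \<Rightarrow> request list" where
  "insertions \<equiv> map (\<lambda>(x, y). Ins x y)"

lemma table_append_Lab [simp]: "table (\<sigma> @ [Lab x]) = table \<sigma>"
  by (simp add: table_def enumerate_append_eq)

lemma table_insertions:
  "table (P @ insertions es) = table P @ List.enumerate (length P) es"
proof (induction es rule: rev_induct)
  case (snoc e es)
  have "table (P @ insertions (es @ [e])) =
      exec_request (length P + length es, case e of (x, y) \<Rightarrow> Ins x y) (table (P @ insertions es))"
    by (simp add: table_def enumerate_append_eq)
  then show ?case
    using snoc by (cases e) (simp add: enumerate_append_eq)
qed simp

text \<open>The range of \<open>m\<close> reaches one past the insertions because
  \<open>probe\<close> also reads the table after the query, which leaves it unchanged.\<close>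

lemma table_take_insertions:
  assumes "table P = []" and "length P \<le> m" and "m \<le> Suc (length P + length es)"
  shows "table (take m (P @ insertions es @ Lab x # Q)) =
    List.enumerate (length P) (take (m - length P) es)"
proof (cases "m = Suc (length P + length es)")
  case True
  then have *: "take m (P @ insertions es @ Lab x # Q) = (P @ insertions es) @ [Lab x]"
    by simp
  show ?thesis
    unfolding * table_append_Lab table_insertions using True assms(1) by simp
next
  case False
  then have "take m (P @ insertions es @ Lab x # Q) = P @ insertions (take (m - length P) es)"
    using assms by (simp add: take_map)
  then show ?thesis
    using assms(1) table_insertions[of P "take (m - length P) es"] by simp
qed

lemma map_of_enumerate:
  "map_of (List.enumerate n xs) i = (if n \<le> i \<and> i < n + length xs then Some (xs ! (i - n)) else None)"
proof (induction xs arbitrary: n)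
  case (Cons a xs)
  then show ?case
    by (auto simp: nth_Cons' Suc_le_eq)
qed simp

text \<open>Labels must agree because announcements reveal them, lengths because probes out of range
  do. As \<open>P\<close> ends with an empty table, handle \<open>length P + l\<close> names row
  \<open>l\<close> of either list.\<close>

lemma same_view_insertions:
  assumes P: "table P = []"
    and len: "length es' = length es"
    and row: "\<And>l. l < length es \<Longrightarrow>
      snd (es ! l) = snd (es' ! l) \<and> length (fst (es ! l)) = length (fst (es' ! l))"
    and entry: "\<And>l j. l < length es \<Longrightarrow> j < length (fst (es ! l)) \<Longrightarrow>
      (length P + l, j) \<notin> D \<Longrightarrow> fst (es ! l) ! j = fst (es' ! l) ! j"
  shows "same_view D (P @ insertions es @ Lab x # Q) (P @ insertions es' @ [Lab x])"
    (is "same_view D ?\<sigma> ?\<tau>")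
proof -
  have ann: "announce ?\<sigma> m = announce ?\<tau> m" if m: "m < length ?\<tau>" for m
  proof -
    have "m < length P \<or> (\<exists>l<length es. m = length P + l) \<or> m = length P + length es"
      using m len by (simp, presburger)
    then consider "m < length P" | l where "m = length P + l" "l < length es"
      | "m = length P + length es"
      by blast
    then show ?thesis
    proof cases
      case 2
      then show ?thesis
        using row[of l] len by (simp add: announce_def nth_append case_prod_beta)
    qed (use len in \<open>simp_all add: announce_def nth_append cong: request.case_cong\<close>)
  qed
  have pro: "probe ?\<sigma> m i j = probe ?\<tau> m i j"
    if m: "m < length ?\<tau>" and ij: "(i, j) \<notin> D" for m i j
  proof (cases "m < length P")
    case True
    then show ?thesis
      by (simp add: probe_def nth_append)
  next
    case False
    define l where "l = m - length P"
    have l: "m = length P + l" "l \<le> length es"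
      using m False len by (auto simp: l_def)
    \<comment> \<open>From \<open>P\<close> on the table only grows, so looking into it before and
      after request \<open>m\<close> shows exactly the rows inserted so far; the minimum caps this
      at the query.\<close>
    have lookup: "(case map_of (table (take m \<rho>) @ table (take (Suc m) \<rho>)) i of None \<Rightarrow> None
        | Some (x, y) \<Rightarrow> if j < length x then Some (x ! j) else None) =
       (if length P \<le> i \<and> i < length P + min (length fs) (Suc l) then
         let x = fst (fs ! (i - length P)) in if j < length x then Some (x ! j) else None else None)"
      if "length fs = length es" "\<rho> = P @ insertions fs @ Lab x # R" for \<rho> fs R
    proof -
      have "table (take m \<rho>) = List.enumerate (length P) (take l fs)"
        "table (take (Suc m) \<rho>) = List.enumerate (length P) (take (Suc l) fs)"
        using table_take_insertions[OF P, of m fs x R] table_take_insertions[OF P, of "Suc m" fs x R]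
          l that by (simp_all add: Suc_diff_le)
      then show ?thesis
        by (auto simp: map_of_enumerate map_add_def Let_def case_prod_beta)
    qed
    show ?thesis
    proof (cases "length P \<le> i \<and> i < length P + length es")
      case True
      then have "i - length P < length es"
        by linarith
      then show ?thesis
        unfolding probe_def lookup[of es, OF refl refl] lookup[of es', OF len refl]
        using row[of "i - length P"] entry[of "i - length P" j] ij True len
        by (auto simp: Let_def case_prod_beta)
    next
      case False
      then show ?thesis
        unfolding probe_def lookup[of es, OF refl refl] lookup[of es', OF len refl]
        using len by auto
    qed
  qed
  show ?thesis
    using ann pro len by (simp add: same_view_def)
qed


section \<open>Forced splits\<close>

lemma filter_replicate_mset:
  "filter_mset P (replicate_mset n a) = (if P a then replicate_mset n a else {#})"
  by (induction n) auto

lemma gini_replicate_mset: "gini (replicate_mset n (x, y)) = 0"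
  by (cases "n = 0") (simp_all add: gini_def label_mean_def)

lemma gini_balanced:
  "k > 0 \<Longrightarrow> gini (replicate_mset k (x, False) + replicate_mset k (x', True)) = 1 / 2"
  by (simp add: gini_def label_mean_def field_simps)

text \<open>One side of the split is all of \<open>S\<close> and the other is empty, so the weighted
  Gini index does not change.\<close>

lemma gini_gain_eq_0:
  assumes "S \<noteq> {#}" and "(\<forall>(x, y)\<in>#S. feature x j \<le> t) \<or> (\<forall>(x, y)\<in>#S. feature x j > t)"
  shows "gini_gain S j t = 0"
  using assms(2)
proof
  assume "\<forall>(x, y)\<in>#S. feature x j \<le> t"
  then have "part_le S j t = S" "part_gt S j t = {#}"
    by (auto simp: part_le_def part_gt_def filter_mset_eq_conv)
  then show ?thesis
    using assms(1) by (simp add: gini_gain_def)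
next
  assume "\<forall>(x, y)\<in>#S. feature x j > t"
  then have "part_gt S j t = S" "part_le S j t = {#}"
    by (auto simp: part_le_def part_gt_def filter_mset_eq_conv)
  then show ?thesis
    using assms(1) by (simp add: gini_gain_def)
qed

lemma feasible_vertex:
  assumes "feasible d k h \<alpha> \<beta> S T" and "subtree_at T v = Some U" and "examples_at T S v = R"
  shows "if size R \<le> k \<or> gini R = 0 \<or> length v = h then is_leaf T v
      else gini R \<ge> \<alpha> \<longrightarrow> \<not> is_leaf T v"
    and "U = Node j a l r \<Longrightarrow> j < d \<and>
      (\<forall>j' a'. j' < d \<longrightarrow> gini_gain R j a \<ge> gini_gain R j' a' - \<beta>)"
    and "U = Leaf b \<Longrightarrow> majority_label R b"
  using assms by (auto simp: feasible_def vertices_def Let_def)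

text \<open>The root has \<open>2 * k\<close> examples and Gini index 1/2, so it must split. Column
  \<open>j\<close> gains 1/2, more than \<open>\<beta>\<close>, while all other columns are constant
  and gain nothing. Splitting on \<open>j\<close> leaves two pure children, whose labels are then
  forced.\<close>

lemma predict_separating_feature:
  assumes S: "S = replicate_mset k (z, False) + replicate_mset k (p, True)"
    and "k \<ge> 1" "h \<ge> 1" "\<alpha> \<le> 1/2" "\<beta> < 1/2"
    and "j < d" and "\<not> z ! j" and "p ! j" and same: "\<And>i. i < d \<Longrightarrow> i \<noteq> j \<Longrightarrow> p ! i = z ! i"
    and feas: "feasible d k h \<alpha> \<beta> S T"
  shows "predict T x = x ! j"
proof -
  have gini: "gini S = 1/2"
    using \<open>k \<ge> 1\<close> gini_balanced S by simp
  have root: "examples_at T S [] = S"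
    by (simp add: examples_at_def filter_mset_eq_conv)
  have "\<not> is_leaf T []"
    using feasible_vertex(1)[OF feas _ root] \<open>k \<ge> 1\<close> \<open>h \<ge> 1\<close> \<open>\<alpha> \<le> 1/2\<close> gini S
    by (auto split: if_splits)
  then obtain i a l r where T: "T = Node i a l r"
    by (cases T) (auto simp: is_leaf_def)
  have i: "i < d" and gain: "gini_gain S i a \<ge> gini_gain S j 0 - \<beta>"
    using feasible_vertex(2)[OF feas _ root, of "Node i a l r"] \<open>j < d\<close> by (simp_all add: T)
  \<comment> \<open>Threshold 0 sends \<open>z\<close> left and \<open>p\<close> right, so both
    sides are pure and the whole Gini index is gained.\<close>
  have "gini_gain S j 0 = 1/2"
    using S gini \<open>\<not> z ! j\<close> \<open>p ! j\<close>
    by (simp add: gini_gain_def part_le_def part_gt_def filter_replicate_mset feature_def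
        gini_replicate_mset)
  then have pos: "gini_gain S i a > 0"
    using gain \<open>\<beta> < 1/2\<close> by simp
  have "S \<noteq> {#}"
    using S \<open>k \<ge> 1\<close> by simp
  have "i = j"
  proof (rule ccontr)
    assume "i \<noteq> j"
    then have "gini_gain S i a = 0"
      using same[OF i] S by (intro gini_gain_eq_0[OF \<open>S \<noteq> {#}\<close>]) (auto simp: feature_def)
    with pos show False by simp
  qed
  \<comment> \<open>Features take only the values 0 and 1, so any other threshold sends all examples
    to one side.\<close>
  moreover have "0 \<le> a \<and> a < 1"
  proof (rule ccontr)
    assume "\<not> ?thesis"
    then have "gini_gain S i a = 0"
      using S by (intro gini_gain_eq_0[OF \<open>S \<noteq> {#}\<close>]) (auto simp: feature_def)
    with pos show False by simp
  qed
  ultimately have goes_right: "\<not> feature q i \<le> a \<longleftrightarrow> q ! j" for q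
    by (auto simp: feature_def)
  have left: "examples_at T S [False] = replicate_mset k (z, False)"
    and right: "examples_at T S [True] = replicate_mset k (p, True)"
    using goes_right[of z] goes_right[of p] \<open>\<not> z ! j\<close> \<open>p ! j\<close>
    by (simp_all add: examples_at_def S T filter_replicate_mset)
  have "is_leaf T [False]" "is_leaf T [True]"
    using feasible_vertex(1)[OF feas _ left] feasible_vertex(1)[OF feas _ right]
    by (simp_all add: T gini_replicate_mset)
  then obtain b b' where leaves: "l = Leaf b" "r = Leaf b'"
    by (auto simp: T is_leaf_def)
  have "majority_label (replicate_mset k (z, False)) b"
    by (rule feasible_vertex(3)[OF feas _ left]) (simp_all add: T leaves)
  moreover have "majority_label (replicate_mset k (p, True)) b'"
    by (rule feasible_vertex(3)[OF feas _ right]) (simp_all add: T leaves)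
  ultimately have "\<not> b" "b'"
    using \<open>k \<ge> 1\<close> by (auto simp: majority_label_def filter_replicate_mset split: if_splits)
  then show ?thesis
    using goes_right[of x] by (auto simp: T leaves)
qed


section \<open>The hard sequences\<close>

lemma active_append_insertions: "active (P @ insertions es) = active P + mset es"
proof (induction es rule: rev_induct)
  case (snoc e es)
  then show ?case
    using active_Ins[of "P @ insertions es"] by (cases e) simp
qed simp

lemma active_append_deletions:
  "active (P @ map (\<lambda>(x, y). Del x y) es) = active P - mset es"
proof (induction es rule: rev_induct)
  case (snoc e es)
  then show ?case
    using active_Del[of "P @ map (\<lambda>(x, y). Del x y) es"] by (cases e) simp
qed simp

lemma table_eq_Nil_iff: "table \<sigma> = [] \<longleftrightarrow> active \<sigma> = {#}"
  by (simp add: active_def)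

lemma valid_requests_Nil: "valid_requests d []"
  by (simp add: valid_requests_def)

lemma valid_requests_snoc:
  "valid_requests d (\<sigma> @ [q]) \<longleftrightarrow> valid_requests d \<sigma> \<and>
    (case q of Ins x y \<Rightarrow> length x = d
     | Del x y \<Rightarrow> length x = d \<and> (x, y) \<in># active \<sigma>
     | Lab x \<Rightarrow> length x = d)"
  by (auto simp: valid_requests_def nth_append All_less_Suc cong: request.case_cong)

lemma valid_requests_insertions:
  assumes "valid_requests d P" and "\<forall>(x, y)\<in>set es. length x = d"
  shows "valid_requests d (P @ insertions es)"
  using assms(2)
proof (induction es rule: rev_induct)
  case (snoc e es)
  then show ?case
    using valid_requests_snoc[of d "P @ insertions es"] by (cases e) simp
qed (use assms(1) in simp)

lemma valid_requests_deletions: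
  assumes "valid_requests d P" and "mset es \<subseteq># active P" and "\<forall>(x, y)\<in>set es. length x = d"
  shows "valid_requests d (P @ map (\<lambda>(x, y). Del x y) es)"
  using assms(2,3)
proof (induction es rule: rev_induct)
  case (snoc e es)
  obtain x y where e: "e = (x, y)"
    by fastforce
  \<comment> \<open>Multiset inclusion counts copies, so one copy of \<open>e\<close> survives the
    deletion of \<open>es\<close>.\<close>
  have sub: "mset es \<subseteq># active P" and "e \<in># active P - mset es"
    using mset_subset_eq_insertD[of e "mset es"] mset_subset_eq_count[OF snoc.prems(1), of e]
      snoc.prems(1) by (auto simp: in_diff_count subset_mset.less_imp_le)
  moreover have "valid_requests d (P @ map (\<lambda>(x, y). Del x y) es)"
    using snoc.IH[OF sub] snoc.prems(2) by simp
  ultimately show ?case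
    using valid_requests_snoc[of d "P @ map (\<lambda>(x, y). Del x y) es" "Del x y"] snoc.prems(2)
    by (simp add: e active_append_deletions)
qed (use assms(1) in simp)

section \<open>The blocks of the hard sequences\<close>

text \<open>Having \<open>k\<close> rows per label puts the root above the pruning size. Fixing the
  order of the labels makes the announcements independent of \<open>p\<close>.\<close>

definition balanced :: "nat \<Rightarrow> point \<Rightarrow> point \<Rightarrow> example list" where
  "balanced k z p = replicate k (z, False) @ replicate k (p, True)"

text \<open>The query comes while the rows are present; the deletions then empty the table, so that
  each block starts afresh. A block has \<open>4 * k\<close> updates.\<close>

definition block :: "nat \<Rightarrow> point \<Rightarrow> point \<Rightarrow> request list" where
  "block k z x =
    insertions (balanced k z z) @ Lab x # map (\<lambda>(x, y). Del x y) (balanced k z z)"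

definition blocks :: "nat \<Rightarrow> point \<Rightarrow> point \<Rightarrow> nat \<Rightarrow> request list" where
  "blocks k z x m = concat (replicate m (block k z x))"

lemma blocks_add: "blocks k z x (m + m') = blocks k z x m @ blocks k z x m'"
  by (simp add: blocks_def replicate_add)

lemma length_balanced [simp]: "length (balanced k z p) = 2 * k"
  by (simp add: balanced_def)

lemma set_balanced: "set (balanced k z p) \<subseteq> {(z, False), (p, True)}"
  by (auto simp: balanced_def)

lemma length_blocks: "length (blocks k z x m) = m * (4 * k + 1)"
  by (induction m) (simp_all add: blocks_def block_def)

lemma num_updates_blocks: "num_updates (blocks k z x m) = 4 * k * m"
  by (induction m)
    (simp_all add: blocks_def block_def balanced_def num_updates_def filter_replicate algebra_simps)

lemma num_labelings_blocks: "num_labelings (blocks k z x m) = m"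
  by (induction m)
    (simp_all add: blocks_def block_def balanced_def num_labelings_def filter_replicate)

lemma blocks_valid_active:
  assumes "length z = d" and "length x = d"
  shows "valid_requests d (blocks k z x m) \<and> active (blocks k z x m) = {#}"
proof (induction m)
  case 0
  then show ?case
    by (simp add: blocks_def valid_requests_Nil active_Nil)
next
  case (Suc m)
  let ?es = "balanced k z z"
  let ?P = "blocks k z x m"
  let ?Q = "(?P @ insertions ?es) @ [Lab x]"
  have len: "\<forall>(x, y)\<in>set ?es. length x = d"
    using set_balanced[of k z z] assms(1) by auto
  have eq: "blocks k z x (Suc m) = ?Q @ map (\<lambda>(x, y). Del x y) ?es"
    using blocks_add[of k z x m 1] by (simp add: blocks_def block_def)
  have active: "active ?Q = mset ?es"
    unfolding active_Lab active_append_insertions using Suc by simp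
  have "valid_requests d ?Q"
    unfolding valid_requests_snoc using valid_requests_insertions[OF _ len] Suc assms(2) by simp
  then show ?case
    unfolding eq using valid_requests_deletions[OF _ _ len, of ?Q] active_append_deletions[of ?Q ?es]
      active by simp
qed


section \<open>The lower bound\<close>

lemma prob_space_coin_space: "prob_space coin_space"
  unfolding coin_space_def by (rule prob_space.prob_space_stream_space) (rule prob_space_measure_pmf)

text \<open>
  Non-measurable sets have measure \<open>0\<close>, so the success probabilities required of the algorithm
  already make the answer events measurable.
\<close>

lemma sets_of_measure_pos: "0 < measure M E \<Longrightarrow> E \<in> sets M"
  by (rule ccontr) (simp add: measure_notin_sets)

text \<open>Used to turn two success probabilities of 2/3 into a probability of 1/3 that both
  answers are correct on the same coins.\<close>

lemma (in prob_space) prob_Int_ge: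
  assumes "E \<in> events" and "F \<in> events"
  shows "prob (E \<inter> F) \<ge> prob E + prob F - 1"
  using measure_Un3[of E M F] assms prob_le_1[of "E \<union> F"] by (simp add: fmeasurable_eq_sets)

text \<open>Linearity of expectation: the sum of the indicators of the events \<open>E p\<close>
  counts those that occur, and this count is pointwise at most the running time.\<close>

lemma expected_running_time_ge:
  assumes "finite K" and "\<And>p. p \<in> K \<Longrightarrow> E p \<in> sets coin_space"
    and "\<And>p. p \<in> K \<Longrightarrow> measure coin_space (E p) \<ge> q"
    and time: "\<And>\<omega>. enat (card {p \<in> K. \<omega> \<in> E p}) \<le> running_time A \<sigma> \<omega>"
  shows "ennreal (real (card K) * q) \<le> expected_running_time A \<sigma>"
proof -
  interpret prob_space coin_space
    by (rule prob_space_coin_space)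
  have "ennreal (real (card K) * q) \<le> ennreal (\<Sum>p\<in>K. measure coin_space (E p))"
    using sum_bounded_below[of K q] assms(3) by (intro ennreal_leI) simp
  also have "\<dots> = (\<Sum>p\<in>K. emeasure coin_space (E p))"
    by (simp add: emeasure_eq_measure)
  also have "\<dots> = (\<integral>\<^sup>+ \<omega>. (\<Sum>p\<in>K. indicator (E p) \<omega>) \<partial>coin_space)"
    using assms(2) by (simp add: nn_integral_sum)
  also have "\<dots> \<le> expected_running_time A \<sigma>"
    unfolding expected_running_time_def
  proof (rule nn_integral_mono)
    fix \<omega>
    have "(\<Sum>p\<in>K. indicator (E p) \<omega>) = (of_nat (card {p \<in> K. \<omega> \<in> E p}) :: ennreal)"
      using \<open>finite K\<close> by (simp add: indicator_def sum.If_cases Int_def)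
    also have "\<dots> = ennreal_of_enat (enat (card {p \<in> K. \<omega> \<in> E p}))"
      by simp
    also have "\<dots> \<le> ennreal_of_enat (running_time A \<sigma> \<omega>)"
      using time by (simp only: ennreal_of_enat_le_iff)
    finally show "(\<Sum>p\<in>K. indicator (E p) \<omega>) \<le> ennreal_of_enat (running_time A \<sigma> \<omega>)" .
  qed
  finally show ?thesis .
qed

text \<open>Compares the full sequence with the one that stops at the query of block
  \<open>m\<close> and has \<open>p\<close> in its positive rows. The first bound on
  \<open>i\<close> is the length of the earlier blocks, where the handles of this block
  begin.\<close>

lemma same_view_balanced:
  assumes len: "length z = d" "length x = d" "length p = d"
    and D: "\<And>i j. m * (4 * k + 1) \<le> i \<Longrightarrow> i < m * (4 * k + 1) + 2 * k \<Longrightarrow>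
      j < d \<Longrightarrow> p ! j \<noteq> z ! j \<Longrightarrow> (i, j) \<in> D"
  shows "same_view D (blocks k z x m @ block k z x @ Q)
    ((blocks k z x m @ insertions (balanced k z p)) @ [Lab x])"
proof -
  have nth: "balanced k z q ! l = (if l < k then (z, False) else (q, True))" if "l < 2 * k" for q l
    using that by (simp add: balanced_def nth_append)
  have "table (blocks k z x m) = []"
    using blocks_valid_active[OF len(1,2)] by (simp add: table_eq_Nil_iff)
  moreover have "z ! j = p ! j" if "l < 2 * k" "j < d" "(length (blocks k z x m) + l, j) \<notin> D" for l j
    using D[of "m * (4 * k + 1) + l" j] that by (auto simp: length_blocks)
  ultimately have "same_view D
      (blocks k z x m @ insertions (balanced k z z) @
        Lab x # map (\<lambda>(x, y). Del x y) (balanced k z z) @ Q)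
      (blocks k z x m @ insertions (balanced k z p) @ [Lab x])"
    by (intro same_view_insertions) (auto simp: nth len split: if_splits)
  then show ?thesis
    by (simp add: block_def)
qed

theorem theorem4p2:
  fixes k h :: nat and \<alpha> \<beta> :: real
  assumes "k \<ge> 1" and "h \<ge> 1"
    and "0 \<le> \<alpha>" and "\<alpha> < 1/2"
    and "0 \<le> \<beta>" and "\<beta> < 1/2"
  shows "\<exists>c>0. \<forall>n\<^sub>0 d\<^sub>0. \<exists>n\<ge>n\<^sub>0. \<exists>d\<ge>d\<^sub>0. \<exists>\<sigma>.
           valid_requests d \<sigma> \<and> num_updates \<sigma> = n \<and> num_labelings \<sigma> \<le> n \<and>
           (\<forall>A. weakly_feasible d k h \<alpha> \<beta> (2/3) A \<longrightarrow>
                expected_running_time A \<sigma> \<ge> ennreal (c * real n * real d))"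
\<comment> \<open>With \<open>n = 4 * k * N\<close> and \<open>d = 2 * e\<close>, the
  \<open>N\<close> blocks cost at least \<open>e / 3\<close> expected steps each, and
  \<open>N * e / 3 = n * d / (24 * k)\<close>.\<close>
proof (intro exI[of _ "1 / (24 * real k)"] conjI allI)
  show "0 < 1 / (24 * real k)"
    using \<open>k \<ge> 1\<close> by simp
next
  fix N e :: nat
  define d where "d = 2 * e"
  define x where "x = replicate e True @ replicate e False"
  define z where "z = replicate d False"
  define \<sigma> where "\<sigma> = blocks k z x N"
  have len: "length z = d" "length x = d"
    by (simp_all add: z_def x_def d_def)
  have valid: "valid_requests d (blocks k z x m)" and empty: "active (blocks k z x m) = {#}" for m
    using blocks_valid_active[OF len] by blast+
  \<comment> \<open>The balance of \<open>x\<close> gives \<open>e\<close> useful columns whichever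
    bit the algorithm prefers.\<close>
  have card_columns: "card {j. j < d \<and> x ! j \<noteq> b} = e" for b
  proof -
    have "{j. j < d \<and> x ! j \<noteq> b} = (if b then {e..<2 * e} else {..<e})"
      by (auto simp: x_def d_def nth_append)
    then show ?thesis
      by simp
  qed
  have "ennreal (1 / (24 * real k) * real (4 * k * N) * real d) \<le> expected_running_time A \<sigma>"
    if A: "weakly_feasible d k h \<alpha> \<beta> (2/3) A" for A
  proof -
    define prefix where
      "prefix m p = blocks k z x m @ insertions (balanced k z p)" for m p
    define ans where
      "ans m p b = {\<omega> \<in> space coin_space. last_answer_is A (prefix m p @ [Lab x]) \<omega> b}" for m p b
    have answers: "\<exists>T. feasible d k h \<alpha> \<beta> (mset (balanced k z p)) T \<and>
        measure coin_space (ans m p (predict T x)) \<ge> 2/3" if "length p = d" for m p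
    proof -
      have "valid_requests d (prefix m p)"
        unfolding prefix_def using valid set_balanced[of k z p] len(1) that
        by (intro valid_requests_insertions) auto
      moreover have "active (prefix m p) = mset (balanced k z p)"
        by (simp add: prefix_def active_append_insertions empty)
      ultimately show ?thesis
        using A len(2) by (auto simp: weakly_feasible_def ans_def)
    qed
    have "\<exists>b. measure coin_space (ans m z b) \<ge> 2/3" for m
      using answers[OF len(1)] by blast
    \<comment> \<open>The preferred bit may vary with the block, since the algorithm may remember
      earlier blocks.\<close>
    then obtain B where B: "measure coin_space (ans m z (B m)) \<ge> 2/3" for m
      by metis
    \<comment> \<open>On \<open>E (m, j)\<close> the same coins yield opposite answers on the zero
      table and on the table with column \<open>j\<close> switched on. \<open>K\<close> keeps the
      columns whose forced answer contradicts \<open>B m\<close>.\<close>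
    define E where "E = (\<lambda>(m, j). ans m z (B m) \<inter> ans m (z[j := True]) (\<not> B m))"
    define K where "K = Sigma {..<N} (\<lambda>m. {j. j < d \<and> x ! j \<noteq> B m})"
    have alt: "measure coin_space (ans m (z[j := True]) (\<not> B m)) \<ge> 2/3" if "(m, j) \<in> K" for m j
    proof -
      have j: "j < d" "x ! j = (\<not> B m)"
        using that by (auto simp: K_def)
      obtain T where T: "feasible d k h \<alpha> \<beta> (mset (balanced k z (z[j := True]))) T"
        "measure coin_space (ans m (z[j := True]) (predict T x)) \<ge> 2/3"
        using answers[of "z[j := True]"] len(1) by auto
      have "predict T x = x ! j"
        by (rule predict_separating_feature[where z = z and p = "z[j := True]",
              OF _ assms(1,2) _ assms(6) j(1) _ _ _ T(1)])
          (use j(1) \<open>\<alpha> < 1/2\<close> in \<open>simp_all add: balanced_def z_def\<close>)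
      with T(2) j(2) show ?thesis
        by simp
    qed
    have sets_E: "E p \<in> sets coin_space" and prob_E: "measure coin_space (E p) \<ge> 1/3"
      if "p \<in> K" for p
    proof -
      obtain m j where p: "p = (m, j)"
        by fastforce
      have *: "ans m z (B m) \<in> sets coin_space" "ans m (z[j := True]) (\<not> B m) \<in> sets coin_space"
        using B[of m] alt[of m j] that p by (auto intro!: sets_of_measure_pos)
      then show "E p \<in> sets coin_space"
        by (simp add: E_def p)
      show "measure coin_space (E p) \<ge> 1/3"
        using prob_space.prob_Int_ge[OF prob_space_coin_space *] B[of m] alt[of m j] that
        by (simp add: E_def p)
    qed
    have "enat (card {p \<in> K. \<omega> \<in> E p}) \<le> running_time A \<sigma> \<omega>" for \<omega>
    proof -
      let ?row = "\<lambda>i m. m * (4 * k + 1) \<le> i \<and> i < m * (4 * k + 1) + 2 * k"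
      have "\<exists>s. \<not> halted \<sigma> (run A \<sigma> \<omega> s) \<and>
          (\<exists>i. A (history (run A \<sigma> \<omega> s)) = Probe i (snd p) \<and> ?row i (fst p))"
        if "p \<in> K" "\<omega> \<in> E p" for p
      proof -
        obtain m j where p: "p = (m, j)"
          by fastforce
        have "N = m + (1 + (N - m - 1))"
          using that(1) p by (simp add: K_def)
        then have \<sigma>: "\<sigma> = blocks k z x m @ block k z x @ blocks k z x (N - m - 1)"
          using blocks_add[of k z x m "1 + (N - m - 1)"] blocks_add[of k z x 1 "N - m - 1"]
          by (simp add: \<sigma>_def blocks_def)
        \<comment> \<open>The zero table differs nowhere from block \<open>m\<close>; the switched
          table differs only in column \<open>j\<close> of its rows. Opposite answers thus force a
          probe in \<open>?D\<close> during the run on \<open>\<sigma>\<close>.\<close>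
        let ?D = "{m * (4 * k + 1)..<m * (4 * k + 1) + 2 * k} \<times> {j}"
        have view: "same_view {} \<sigma> (prefix m z @ [Lab x])"
          unfolding \<sigma> prefix_def by (rule same_view_balanced[OF len len(1)]) simp
        have view': "same_view ?D \<sigma> (prefix m (z[j := True]) @ [Lab x])"
          unfolding \<sigma> prefix_def
        proof (rule same_view_balanced[OF len])
          show "(i, j') \<in> ?D" if "m * (4 * k + 1) \<le> i" "i < m * (4 * k + 1) + 2 * k"
            "z[j := True] ! j' \<noteq> z ! j'" for i j'
            using that by (cases "j' = j") auto
        qed (simp add: len)
        have "last_answer_is A (prefix m z @ [Lab x]) \<omega> (B m)"
          "last_answer_is A (prefix m (z[j := True]) @ [Lab x]) \<omega> (\<not> B m)"
          using that(2) by (simp_all add: p E_def ans_def)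
        from different_answers_probe[OF view view' _ _ this]
        show ?thesis
          by (auto simp: p prefix_def)
      qed
      then obtain f where f: "\<And>p. p \<in> K \<Longrightarrow> \<omega> \<in> E p \<Longrightarrow> \<not> halted \<sigma> (run A \<sigma> \<omega> (f p))"
        "\<And>p. p \<in> K \<Longrightarrow> \<omega> \<in> E p \<Longrightarrow>
          \<exists>i. A (history (run A \<sigma> \<omega> (f p))) = Probe i (snd p) \<and> ?row i (fst p)"
        by metis
      \<comment> \<open>A block has \<open>4 * k + 1\<close> requests, so the probed handle
        determines the block. With the probed column it recovers the pair, hence different pairs are
        served by different steps.\<close>
      have div: "i div (4 * k + 1) = m" if "?row i m" for i m
        using that by (intro div_nat_eqI) (simp_all add: algebra_simps)
      have "inj_on f {p \<in> K. \<omega> \<in> E p}"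
      proof (rule inj_onI)
        fix p q
        assume "p \<in> {p \<in> K. \<omega> \<in> E p}" "q \<in> {p \<in> K. \<omega> \<in> E p}" and eq: "f p = f q"
        then obtain i i' where
          "A (history (run A \<sigma> \<omega> (f p))) = Probe i (snd p)" "?row i (fst p)"
          "A (history (run A \<sigma> \<omega> (f q))) = Probe i' (snd q)" "?row i' (fst q)"
          using f(2)[of p] f(2)[of q] by blast
        then show "p = q"
          using eq div[of "fst p" i] div[of "fst q" i'] by (simp add: prod_eq_iff)
      qed
      then show ?thesis
        by (rule card_le_running_time) (use f(1) in blast)
    qed
    then have "ennreal (real (card K) * (1/3)) \<le> expected_running_time A \<sigma>"
      using sets_E prob_E by (intro expected_running_time_ge[where E = E]) (simp_all add: K_def)
    moreover have "card K = N * e"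
    proof -
      have "card K = (\<Sum>m<N. card {j. j < d \<and> x ! j \<noteq> B m})"
        unfolding K_def by (rule card_SigmaI) auto
      also have "\<dots> = N * e"
        unfolding card_columns by simp
      finally show ?thesis .
    qed
    then have "real (card K) * (1/3) = 1 / (24 * real k) * real (4 * k * N) * real d"
      using \<open>k \<ge> 1\<close> by (simp add: d_def field_simps)
    ultimately show ?thesis
      by simp
  qed
  moreover have "N \<le> 4 * k * N"
    using \<open>k \<ge> 1\<close> by simp
  ultimately show "\<exists>n\<ge>N. \<exists>d\<ge>e. \<exists>\<sigma>. valid_requests d \<sigma> \<and> num_updates \<sigma> = n \<and>
      num_labelings \<sigma> \<le> n \<and> (\<forall>A. weakly_feasible d k h \<alpha> \<beta> (2/3) A \<longrightarrow>
        expected_running_time A \<sigma> \<ge> ennreal (1 / (24 * real k) * real n * real d))"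
    using valid[of N] num_updates_blocks[of k z x N] num_labelings_blocks[of k z x N]
    by (intro exI[of _ "4 * k * N"] exI[of _ d] exI[of _ \<sigma>] conjI) (auto simp: \<sigma>_def d_def)
qed

end
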